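(* Let $\mathcal{G}=\{G_1,\dots,G_s\}$ be a set of real $n\times n$ matrices, let $A\in\mathbb{R}^{m\times n}$, $b\in\mathbb{R}^m$, and $P=\{x\in\mathbb{R}^n\mid Ax\le b\}$. Let $E\subseteq P$ be convex and invariant with respect to $\mathcal{G}$. Then $$I_r(E)\subseteq\mathcal{S}\quad\text{and}\quad I_r(E)\subseteq I_{r+1}(E)\quad\text{for all integers } r\ge 0.$$ Moreover, if $P$ is bounded, $\rho(\mathcal{G})<1$, and $E$ contains the origin in its interior, then there exists a nonnegative integer $t$ such that $\mathcal{S}=I_r(E)$ for all $r\ge t$.
   Context: Inequalities between vectors are entrywise. $E$ is invariant with respect to $\mathcal{G}$ if $x\in E$ implies $G_ix\in E$ for all $i=1,\dots,s$. $\mathcal{G}^k$ denotes the set of all products of length $k$ of matrices from $\mathcal{G}$ ($\mathcal{G}^0=\{I\}$). Define $\mathcal{S}:=\bigcap_{k=0}^{\infty}\{x\in\mathbb{R}^n\mid AGx\le b\ \ \forall G\in\mathcal{G}^k\}$, $S_r:=\bigcap_{k=0}^{r}\{x\in\mathbb{R}^n\mid AGx\le b\ \ \forall G\in\mathcal{G}^k\}$ for $r\ge 0$, $S_{-1}:=\mathbb{R}^n$, and $I_r(E):=S_{r-1}\cap\{x\in\mathbb{R}^n\mid Gx\in E\ \ \forall G\in\mathcal{G}^r\}$ for integers $r\ge0$. The joint spectral radius of $\mathcal{G}$ is $\rho(\mathcal{G}):=\lim_{k\to\infty}\max_{\sigma\in\{1,\dots,s\}^k}\|G_{\sigma_1}\cdots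 G_{\sigma_k}\|^{1/k}$ (independent of the matrix norm used). *)

theory Defs
  imports "HOL-Analysis.Analysis"
begin

(* The order on vectors below is the library's entrywise order on real ^ 'm. *)

definition polyhedral_set :: "real ^ 'n ^ 'm \<Rightarrow> real ^ 'm \<Rightarrow> (real ^ 'n) set" where
  "polyhedral_set A b = {x. A *v x \<le> b}"

definition products :: "(real ^ 'n ^ 'n) set \<Rightarrow> nat \<Rightarrow> (real ^ 'n ^ 'n) set" where
  "products \<G> k = {foldr (**) Ms (mat 1) | Ms. length Ms = k \<and> set Ms \<subseteq> \<G>}"

definition invariant_under :: "(real ^ 'n ^ 'n) set \<Rightarrow> (real ^ 'n) set \<Rightarrow> bool" where
  "invariant_under \<G> E \<longleftrightarrow> (\<forall>x\<in>E. \<forall>G\<in>\<G>. G *v x \<in> E)"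

(* The matrix norm is the operator norm induced by the Euclidean norm; the limit does not
   depend on this choice. The maximum over index words of length k is taken over the set of
   the corresponding products, which is finite and nonempty if \<G> is. The value of the
   sequence at k = 0 is irrelevant for the limit. *)
definition joint_spectral_radius :: "(real ^ 'n ^ 'n) set \<Rightarrow> real" where
  "joint_spectral_radius \<G> =
     lim (\<lambda>k. Max ((\<lambda>M. root k (onorm ((*v) M))) ` products \<G> k))"

definition S_inf ::
  "(real ^ 'n ^ 'n) set \<Rightarrow> real ^ 'n ^ 'm \<Rightarrow> real ^ 'm \<Rightarrow> (real ^ 'n) set" where
  "S_inf \<G> A b = (\<Inter>k::nat. {x. \<forall>G\<in>products \<G> k. (A ** G) *v x \<le> b})"

(* The index r ranges over the integers so that r = -1 is covered: the intersection is then
   empty and the set is the whole space. *)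
definition S_upto ::
  "(real ^ 'n ^ 'n) set \<Rightarrow> real ^ 'n ^ 'm \<Rightarrow> real ^ 'm \<Rightarrow> int \<Rightarrow> (real ^ 'n) set" where
  "S_upto \<G> A b r =
     (\<Inter>k\<in>{k::nat. int k \<le> r}. {x. \<forall>G\<in>products \<G> k. (A ** G) *v x \<le> b})"

lemma S_upto_minus_1: "S_upto \<G> A b (-1) = UNIV"
  by (simp add: S_upto_def)

definition I_set ::
  "(real ^ 'n ^ 'n) set \<Rightarrow> real ^ 'n ^ 'm \<Rightarrow> real ^ 'm \<Rightarrow> nat \<Rightarrow> (real ^ 'n) set \<Rightarrow> (real ^ 'n) set"
  where
  "I_set \<G> A b r E = S_upto \<G> A b (int r - 1) \<inter> {x. \<forall>G\<in>products \<G> r. G *v x \<in> E}"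

end

theory Submission
  imports Defs
begin

text \<open>
  A product of length \<open>k \<ge> r\<close> splits into a left factor of length \<open>k - r\<close> and a right factor of
  length \<open>r\<close>. For a point of \<open>I_r(E)\<close> the right factor already sends it into \<open>E\<close>, and by
  invariance the left factor keeps it there; since \<open>E \<subseteq> P\<close>, all constraints of length at least
  \<open>r\<close> hold, and the shorter ones hold by definition. This gives both inclusions.

  For the converse inclusion \<open>\<S> \<subseteq> I_r(E)\<close> with large \<open>r\<close>, note that \<open>\<S>\<close> is contained in the
  bounded set \<open>P\<close> (take the empty product), so it suffices that all products of length \<open>r\<close> are
  so small in norm that they send \<open>P\<close> into a fixed ball around the origin inside \<open>E\<close>. The largest
  norm of a product of length \<open>k\<close> is submultiplicative in \<open>k\<close>. By Fekete's argument its \<open>k\<close>-th root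
  converges, so the joint spectral radius is a genuine limit of these roots, and not the arbitrary
  value that \<open>lim\<close> takes on divergent sequences. If this limit is below 1, one of the roots is
  below 1, and submultiplicativity forces geometric decay of the largest norm. Both
  steps rest on the bound in \<open>submultiplicative_geometric_bound\<close>.
\<close>

section \<open>Submultiplicative sequences\<close>

text \<open>
  Splitting off blocks of length \<open>m\<close> costs a factor \<open>c ^ m\<close> each and leaves a remainder of length
  below \<open>m\<close>; the constant absorbs the finitely many possible remainders.
\<close>

lemma submultiplicative_geometric_bound:
  fixes u :: "nat \<Rightarrow> real"
  assumes nonneg: "\<And>n. 0 \<le> u n"
    and submult: "\<And>m n. u (m + n) \<le> u m * u n"
    and "0 < m" and "0 < c" and um: "u m \<le> c ^ m"
  obtains C where "0 < C" and "\<And>n. u n \<le> C * c ^ n"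
proof
  let ?C = "1 + (\<Sum>r<m. u r / c ^ r)"
  have "0 \<le> (\<Sum>r<m. u r / c ^ r)"
    using nonneg \<open>0 < c\<close> by (intro sum_nonneg) simp
  then show C_pos: "0 < ?C" by linarith
  show "u n \<le> ?C * c ^ n" for n
  proof (induction n rule: less_induct)
    case (less n)
    show ?case
    proof (cases "n < m")
      case True
      have "u n / c ^ n \<le> (\<Sum>r<m. u r / c ^ r)"
        using True nonneg \<open>0 < c\<close> by (intro member_le_sum) auto
      then have "u n / c ^ n \<le> ?C" by linarith
      then show ?thesis using \<open>0 < c\<close> by (simp add: divide_le_eq)
    next
      case False
      have "u n \<le> u m * u (n - m)"
        using submult[of m "n - m"] False by simp
      also have "\<dots> \<le> c ^ m * (?C * c ^ (n - m))"
        using um less[of "n - m"] False \<open>0 < m\<close> \<open>0 < c\<close> nonneg by (intro mult_mono) auto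
      also have "\<dots> = ?C * (c ^ m * c ^ (n - m))" by simp
      also have "c ^ m * c ^ (n - m) = c ^ n"
        using False by (simp flip: power_add)
      finally show ?thesis .
    qed
  qed
qed

text \<open>
  This is Fekete's lemma in multiplicative form: the roots converge to their infimum, because any
  \<open>c\<close> above the infimum is a geometric growth rate of \<open>u\<close> up to a constant factor, whose roots
  tend to 1.
\<close>

lemma submultiplicative_root_convergent:
  fixes u :: "nat \<Rightarrow> real"
  assumes nonneg: "\<And>n. 0 \<le> u n"
    and submult: "\<And>m n. u (m + n) \<le> u m * u n"
  shows "convergent (\<lambda>n. root n (u n))"
proof -
  define L where "L = (INF n\<in>{1..}. root n (u n))"
  have bdd: "bdd_below ((\<lambda>n. root n (u n)) ` {1..})"
    using nonneg by (intro bdd_belowI2[where m = 0]) (simp add: real_root_ge_zero)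
  have "0 \<le> L"
    unfolding L_def using nonneg by (intro cINF_greatest) (auto simp: real_root_ge_zero)
  have "(\<lambda>n. root n (u n)) \<longlonglongrightarrow> L"
  proof (rule order_tendstoI)
    fix a assume "a < L"
    have "a < root n (u n)" if "n \<ge> 1" for n
      using cINF_lower[OF bdd, of n] that \<open>a < L\<close> by (simp add: L_def)
    then show "\<forall>\<^sub>F n in sequentially. a < root n (u n)"
      unfolding eventually_sequentially by blast
  next
    fix a assume "L < a"
    then obtain c where c: "L < c" "c < a" using dense by blast
    with \<open>0 \<le> L\<close> have "0 < c" by linarith
    obtain m where m: "m \<ge> 1" "root m (u m) < c"
      using c(1) cINF_less_iff[OF _ bdd, of c] by (auto simp: L_def)
    have "u m = root m (u m) ^ m"
      using m(1) nonneg by simp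
    also have "\<dots> \<le> c ^ m"
      using m nonneg by (intro power_mono) (auto simp: real_root_ge_zero)
    finally obtain C where C: "0 < C" "\<And>n. u n \<le> C * c ^ n"
      using submultiplicative_geometric_bound[OF nonneg submult, of m c] m(1) \<open>0 < c\<close> by auto
    have "(\<lambda>n. root n C * c) \<longlonglongrightarrow> 1 * c"
      by (intro tendsto_intros LIMSEQ_root_const C(1))
    then have "\<forall>\<^sub>F n in sequentially. root n C * c < a"
      using c(2) by (simp add: order_tendstoD(2))
    then show "\<forall>\<^sub>F n in sequentially. root n (u n) < a"
      using eventually_gt_at_top[of 0]
    proof eventually_elim
      case (elim n)
      have "root n (u n) \<le> root n (C * c ^ n)"
        using elim(2) C(2) by simp
      also have "\<dots> = root n C * c"
        using elim(2) \<open>0 < c\<close> by (simp add: real_root_mult real_root_power_cancel)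
      finally show ?case using elim(1) by linarith
    qed
  qed
  then show ?thesis by (rule convergentI)
qed

text \<open>
  A limit below 1 yields a single \<open>m > 0\<close> whose root is below some \<open>c < 1\<close>, which already makes the
  whole sequence decay like \<open>c ^ n\<close>.
\<close>

lemma submultiplicative_tendsto_zero:
  fixes u :: "nat \<Rightarrow> real"
  assumes nonneg: "\<And>n. 0 \<le> u n"
    and submult: "\<And>m n. u (m + n) \<le> u m * u n"
    and lim: "lim (\<lambda>n. root n (u n)) < 1"
  shows "u \<longlonglongrightarrow> 0"
proof -
  \<comment> \<open>The maximum with 0 makes the rate positive, as the geometric bound divides by its powers.\<close>
  obtain c where c: "0 < c" "c < 1" "lim (\<lambda>n. root n (u n)) < c"
    using lim dense[of "max 0 (lim (\<lambda>n. root n (u n)))" 1] by auto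
  have "(\<lambda>n. root n (u n)) \<longlonglongrightarrow> lim (\<lambda>n. root n (u n))"
    using submultiplicative_root_convergent[OF nonneg submult]
    by (simp add: convergent_LIMSEQ_iff)
  then have "\<forall>\<^sub>F n in sequentially. root n (u n) < c"
    using c(3) by (rule order_tendstoD(2))
  then have "\<forall>\<^sub>F n in sequentially. root n (u n) < c \<and> 0 < n"
    using eventually_gt_at_top[of 0] by eventually_elim simp
  then obtain m where m: "root m (u m) < c" "0 < m"
    using eventually_happens'[OF sequentially_bot] by blast
  have "u m = root m (u m) ^ m"
    using m(2) nonneg by simp
  also have "\<dots> \<le> c ^ m"
    using m nonneg by (intro power_mono) (auto simp: real_root_ge_zero)
  finally obtain C where C: "0 < C" "\<And>n. u n \<le> C * c ^ n"
    using submultiplicative_geometric_bound[OF nonneg submult m(2) c(1)] by auto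
  have "(\<lambda>n. C * c ^ n) \<longlonglongrightarrow> 0"
    using c by (intro tendsto_mult_right_zero LIMSEQ_power_zero) auto
  then show ?thesis
    using C(2) nonneg
    by (intro Lim_null_comparison[of u "\<lambda>n. C * c ^ n"]) simp_all
qed

section \<open>Products of matrices\<close>

lemma foldr_matrix_mult_append:
  fixes Ms Ns :: "(real ^ 'n ^ 'n) list"
  shows "foldr (**) (Ms @ Ns) (mat 1) = foldr (**) Ms (mat 1) ** foldr (**) Ns (mat 1)"
  by (induction Ms) (simp_all add: matrix_mul_assoc)

lemma products_addE:
  assumes "G \<in> products \<G> (j + k)"
  obtains H K where "H \<in> products \<G> j" and "K \<in> products \<G> k" and "G = H ** K"
proof -
  obtain Ms where Ms: "G = foldr (**) Ms (mat 1)" "length Ms = j + k" "set Ms \<subseteq> \<G>"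
    using assms by (auto simp: products_def)
  show ?thesis
  proof
    show "foldr (**) (take j Ms) (mat 1) \<in> products \<G> j"
      using Ms set_take_subset[of j Ms] by (fastforce simp: products_def)
    show "foldr (**) (drop j Ms) (mat 1) \<in> products \<G> k"
      using Ms set_drop_subset[of j Ms] by (fastforce simp: products_def)
    show "G = foldr (**) (take j Ms) (mat 1) ** foldr (**) (drop j Ms) (mat 1)"
      by (simp add: Ms(1) flip: foldr_matrix_mult_append)
  qed
qed

lemma products_0 [simp]: "products \<G> 0 = {mat 1}"
  by (auto simp: products_def)

lemma finite_products:
  assumes "finite \<G>"
  shows "finite (products \<G> k)"
proof -
  have "products \<G> k = (\<lambda>Ms. foldr (**) Ms (mat 1)) ` {Ms. set Ms \<subseteq> \<G> \<and> length Ms = k}"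
    by (auto simp: products_def)
  then show ?thesis
    using finite_lists_length_eq[OF assms, of k] by simp
qed

lemma products_nonempty:
  assumes "\<G> \<noteq> {}"
  shows "products \<G> k \<noteq> {}"
proof -
  obtain G where "G \<in> \<G>" using assms by blast
  then have "foldr (**) (replicate k G) (mat 1) \<in> products \<G> k"
    unfolding products_def by fastforce
  then show ?thesis by blast
qed

lemma invariant_under_products:
  assumes inv: "invariant_under \<G> E" and "x \<in> E" and "G \<in> products \<G> k"
  shows "G *v x \<in> E"
proof -
  have "foldr (**) Ms (mat 1) *v x \<in> E" if "set Ms \<subseteq> \<G>" for Ms
    using that
  proof (induction Ms)
    case Nil
    then show ?case using \<open>x \<in> E\<close> by simp
  next
    case (Cons M Ms)
    then show ?case
      using inv by (simp add: invariant_under_def flip: matrix_vector_mul_assoc)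
  qed
  then show ?thesis using assms(3) by (auto simp: products_def)
qed

definition max_product_norm :: "(real ^ 'n ^ 'n) set \<Rightarrow> nat \<Rightarrow> real" where
  "max_product_norm \<G> k = Max ((\<lambda>M. onorm ((*v) M)) ` products \<G> k)"

lemma onorm_le_max_product_norm:
  assumes "finite \<G>" and "M \<in> products \<G> k"
  shows "onorm ((*v) M) \<le> max_product_norm \<G> k"
  unfolding max_product_norm_def using assms by (intro Max_ge) (auto simp: finite_products)

lemma max_product_norm_nonneg:
  assumes "finite \<G>" and "\<G> \<noteq> {}"
  shows "0 \<le> max_product_norm \<G> k"
proof -
  obtain M where "M \<in> products \<G> k" using products_nonempty[OF assms(2)] by blast
  then show ?thesis
    using onorm_le_max_product_norm[OF assms(1)] onorm_pos_le[OF matrix_vector_mul_bounded_linear]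
    by (meson order_trans)
qed

lemma max_product_norm_submultiplicative:
  assumes fin: "finite \<G>" and ne: "\<G> \<noteq> {}"
  shows "max_product_norm \<G> (j + k) \<le> max_product_norm \<G> j * max_product_norm \<G> k"
proof -
  have "onorm ((*v) G) \<le> max_product_norm \<G> j * max_product_norm \<G> k"
    if "G \<in> products \<G> (j + k)" for G
  proof -
    obtain H K where HK: "H \<in> products \<G> j" "K \<in> products \<G> k" "G = H ** K"
      using \<open>G \<in> products \<G> (j + k)\<close> by (rule products_addE)
    have "(*v) G = (*v) H \<circ> (*v) K"
      by (simp add: HK(3) fun_eq_iff matrix_vector_mul_assoc)
    then have "onorm ((*v) G) \<le> onorm ((*v) H) * onorm ((*v) K)"
      by (simp add: onorm_compose)
    also have "\<dots> \<le> max_product_norm \<G> j * max_product_norm \<G> k"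
      using HK onorm_le_max_product_norm[OF fin] max_product_norm_nonneg[OF fin ne]
      by (intro mult_mono) (auto simp: onorm_pos_le)
    finally show ?thesis .
  qed
  then show ?thesis
    unfolding max_product_norm_def[of \<G> "j + k"]
    using finite_products[OF fin] products_nonempty[OF ne] by (subst Max_le_iff) auto
qed

text \<open>
  Roots are monotone, so they commute with the maximum. This also covers \<open>k = 0\<close>, because
  \<open>root 0\<close> is constantly 0.
\<close>

lemma joint_spectral_radius_eq_lim_root:
  assumes fin: "finite \<G>" and ne: "\<G> \<noteq> {}"
  shows "joint_spectral_radius \<G> = lim (\<lambda>k. root k (max_product_norm \<G> k))"
proof -
  have "Max ((\<lambda>M. root k (onorm ((*v) M))) ` products \<G> k) = root k (max_product_norm \<G> k)" for k
  proof -
    have "mono (root k)"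
      by (cases "k = 0") (auto intro!: monoI)
    then have "root k (max_product_norm \<G> k) = Max (root k ` (\<lambda>M. onorm ((*v) M)) ` products \<G> k)"
      unfolding max_product_norm_def
      using finite_products[OF fin] products_nonempty[OF ne] by (intro mono_Max_commute) auto
    then show ?thesis by (simp add: image_image)
  qed
  then show ?thesis by (simp add: joint_spectral_radius_def)
qed

lemma max_product_norm_tendsto_zero:
  assumes "finite \<G>" and "\<G> \<noteq> {}" and "joint_spectral_radius \<G> < 1"
  shows "max_product_norm \<G> \<longlonglongrightarrow> 0"
  using assms
  by (intro submultiplicative_tendsto_zero)
    (simp_all add: max_product_norm_nonneg max_product_norm_submultiplicative
      joint_spectral_radius_eq_lim_root)

text \<open>
  With \<open>R\<close> bounding \<open>D\<close> and an \<open>e\<close>-ball around 0 inside \<open>E\<close>, it is enough that the largest norm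
  is below \<open>e / R\<close>.
\<close>

lemma products_eventually_map_bounded_into:
  fixes \<G> :: "(real ^ 'n ^ 'n) set"
  assumes fin: "finite \<G>" and ne: "\<G> \<noteq> {}" and jsr: "joint_spectral_radius \<G> < 1"
    and "bounded D" and "0 \<in> interior E"
  shows "\<forall>\<^sub>F r in sequentially. \<forall>G\<in>products \<G> r. \<forall>x\<in>D. G *v x \<in> E"
proof -
  obtain R where R: "0 < R" "\<And>x. x \<in> D \<Longrightarrow> norm x \<le> R"
    using \<open>bounded D\<close> by (auto simp: bounded_pos)
  obtain e where e: "0 < e" "ball 0 e \<subseteq> E"
    using \<open>0 \<in> interior E\<close> by (auto simp: mem_interior)
  have "\<forall>\<^sub>F r in sequentially. max_product_norm \<G> r < e / R"
    using max_product_norm_tendsto_zero[OF fin ne jsr] e(1) R(1) by (simp add: order_tendstoD(2))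
  then show ?thesis
  proof eventually_elim
    case (elim r)
    show ?case
    proof (intro ballI)
      fix G x assume "G \<in> products \<G> r" "x \<in> D"
      have "norm (G *v x) \<le> onorm ((*v) G) * norm x"
        by (rule onorm[OF matrix_vector_mul_bounded_linear])
      also have "\<dots> \<le> max_product_norm \<G> r * R"
        using onorm_le_max_product_norm[OF fin \<open>G \<in> products \<G> r\<close>] R(2)[OF \<open>x \<in> D\<close>]
          max_product_norm_nonneg[OF fin ne] by (intro mult_mono) auto
      also have "\<dots> < e"
        using elim R(1) by (simp add: less_divide_eq)
      finally show "G *v x \<in> E"
        using e(2) by auto
    qed
  qed
qed

section \<open>The inner approximations\<close>

text \<open>
  The rightmost \<open>r\<close> factors act first and bring the point into \<open>E\<close>; the remaining ones cannot
  leave it.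
\<close>

lemma I_set_maps_into:
  assumes inv: "invariant_under \<G> E" and x: "x \<in> I_set \<G> A b r E"
    and "r \<le> k" and "G \<in> products \<G> k"
  shows "G *v x \<in> E"
proof -
  have "G \<in> products \<G> (k - r + r)"
    using \<open>G \<in> products \<G> k\<close> \<open>r \<le> k\<close> by simp
  then obtain H K where HK: "H \<in> products \<G> (k - r)" "K \<in> products \<G> r" "G = H ** K"
    by (rule products_addE)
  have "K *v x \<in> E" using x HK(2) by (simp add: I_set_def)
  then have "H *v (K *v x) \<in> E" by (rule invariant_under_products[OF inv _ HK(1)])
  then show ?thesis by (simp add: HK(3) matrix_vector_mul_assoc)
qed

lemma I_set_subset_S_inf:
  assumes sub: "E \<subseteq> polyhedral_set A b" and inv: "invariant_under \<G> E"
  shows "I_set \<G> A b r E \<subseteq> S_inf \<G> A b"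
proof
  fix x assume x: "x \<in> I_set \<G> A b r E"
  have "(A ** G) *v x \<le> b" if G: "G \<in> products \<G> k" for k G
  proof (cases "r \<le> k")
    case True
    then have "G *v x \<in> polyhedral_set A b"
      using I_set_maps_into[OF inv x True G] sub by blast
    then show ?thesis
      by (simp add: polyhedral_set_def matrix_vector_mul_assoc)
  next
    case False
    then have "int k \<le> int r - 1" by simp
    then show ?thesis using x G unfolding I_set_def S_upto_def by blast
  qed
  then show "x \<in> S_inf \<G> A b" by (simp add: S_inf_def)
qed

lemma S_inf_subset_S_upto: "S_inf \<G> A b \<subseteq> S_upto \<G> A b r"
  by (auto simp: S_inf_def S_upto_def)

lemma S_inf_subset_polyhedral_set: "S_inf \<G> A b \<subseteq> polyhedral_set A b"
proof
  fix x assume "x \<in> S_inf \<G> A b"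
  then have "\<forall>G\<in>products \<G> 0. (A ** G) *v x \<le> b"
    unfolding S_inf_def by blast
  then show "x \<in> polyhedral_set A b" by (simp add: polyhedral_set_def)
qed

lemma I_set_subset_I_set_Suc:
  assumes "E \<subseteq> polyhedral_set A b" and inv: "invariant_under \<G> E"
  shows "I_set \<G> A b r E \<subseteq> I_set \<G> A b (r + 1) E"
proof
  fix x assume x: "x \<in> I_set \<G> A b r E"
  then have "x \<in> S_upto \<G> A b (int (r + 1) - 1)"
    using I_set_subset_S_inf[OF assms] S_inf_subset_S_upto by blast
  moreover have "\<forall>G\<in>products \<G> (r + 1). G *v x \<in> E"
    using I_set_maps_into[OF inv x, of "r + 1"] by simp
  ultimately show "x \<in> I_set \<G> A b (r + 1) E"
    unfolding I_set_def by blast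
qed

theorem lemma3p3:
  fixes \<G> :: "(real ^ 'n ^ 'n) set"
    and A :: "real ^ 'n ^ 'm"
    and b :: "real ^ 'm"
    and E :: "(real ^ 'n) set"
  assumes "finite \<G>" and "\<G> \<noteq> {}"
    and "E \<subseteq> polyhedral_set A b"
    and "convex E"
    and "invariant_under \<G> E"
  shows "(\<forall>r. I_set \<G> A b r E \<subseteq> S_inf \<G> A b \<and> I_set \<G> A b r E \<subseteq> I_set \<G> A b (r + 1) E) \<and>
    (bounded (polyhedral_set A b) \<and> joint_spectral_radius \<G> < 1 \<and> 0 \<in> interior E \<longrightarrow>
      (\<exists>t. \<forall>r\<ge>t. S_inf \<G> A b = I_set \<G> A b r E))"
proof (intro conjI allI impI)
  show "I_set \<G> A b r E \<subseteq> S_inf \<G> A b" for r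
    by (rule I_set_subset_S_inf[OF assms(3,5)])
  show "I_set \<G> A b r E \<subseteq> I_set \<G> A b (r + 1) E" for r
    by (rule I_set_subset_I_set_Suc[OF assms(3,5)])
next
  assume "bounded (polyhedral_set A b) \<and> joint_spectral_radius \<G> < 1 \<and> 0 \<in> interior E"
  then obtain t where t: "\<And>r G x. r \<ge> t \<Longrightarrow> G \<in> products \<G> r \<Longrightarrow> x \<in> polyhedral_set A b \<Longrightarrow> G *v x \<in> E"
    using products_eventually_map_bounded_into[OF assms(1,2)]
    unfolding eventually_sequentially by meson
  have "S_inf \<G> A b = I_set \<G> A b r E" if "r \<ge> t" for r
  proof
    show "S_inf \<G> A b \<subseteq> I_set \<G> A b r E"
      using t[OF that] S_inf_subset_polyhedral_set S_inf_subset_S_upto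
      unfolding I_set_def by blast
  qed (rule I_set_subset_S_inf[OF assms(3,5)])
  then show "\<exists>t. \<forall>r\<ge>t. S_inf \<G> A b = I_set \<G> A b r E" by blast
qed

end
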